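(* Let $n$ be a positive integer and let $E_O(n)=\{(a,b)\in E^H(n): \Omega(a)\text{ is odd}\}$. Then $|E_O(n)|=\lfloor |E^H(n)|/2\rfloor$.
   Context: $V(n)$ is the set of positive divisors of $n$; $\Omega(a)$ is the number of prime factors of $a$ counted with multiplicity. $E^H(n)$ is the arc set of the Hasse diagram of $n$: the pairs $(a,b)$ with $a,b\in V(n)$, $a<b$, $a\mid b$, such that there is no $c\in V(n)$ with $a<c<b$, $a\mid c$, $c\mid b$. *)

theory Defs
  imports "HOL-Computational_Algebra.Primes"
begin

definition V :: "nat \<Rightarrow> nat set" where
  "V n = {d. 0 < d \<and> d dvd n}"

definition Omega :: "nat \<Rightarrow> nat" where
  "Omega a = size (prime_factorization a)"

definition E_H :: "nat \<Rightarrow> (nat \<times> nat) set" where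
  "E_H n = {(a, b). a \<in> V n \<and> b \<in> V n \<and> a < b \<and> a dvd b \<and>
              \<not> (\<exists>c \<in> V n. a < c \<and> c < b \<and> a dvd c \<and> c dvd b)}"

definition E_O :: "nat \<Rightarrow> (nat \<times> nat) set" where
  "E_O n = {(a, b) \<in> E_H n. odd (Omega a)}"

end

theory Submission
  imports Defs "HOL-Computational_Algebra.Nth_Powers"
begin

text \<open>
  Sorting the covering pairs \<open>(a, p a)\<close> by the prime \<open>p\<close>, the number of pairs with
  \<open>\<Omega>(a)\<close> even minus the number of pairs with \<open>\<Omega>(a)\<close> odd is the sum over the primes
  \<open>p\<close> dividing \<open>n\<close> of \<open>\<Sum>\<^sub>a\<^sub>|\<^sub>n\<^sub>/\<^sub>p (-1)\<^bsup>\<Omega>(a)\<^esup>\<close>. This inner sum is 1 if \<open>n/p\<close> is a square and 0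
  otherwise, and \<open>n/p\<close> is a square for at most one \<open>p\<close>, since then \<open>p\<close> is the only prime
  with odd multiplicity in \<open>n\<close>. Hence the difference is 0 or 1.
\<close>

lemma finite_V: "n > 0 \<Longrightarrow> finite (V n)"
  unfolding V_def by auto

lemma Omega_prime_mult: "prime p \<Longrightarrow> a > 0 \<Longrightarrow> Omega (p * a) = Suc (Omega a)"
  unfolding Omega_def by (simp add: prime_factorization_mult prime_factorization_prime)

definition liouville_sum :: "nat \<Rightarrow> int" where
  "liouville_sum n = (\<Sum>a\<in>V n. (-1) ^ Omega a)"

text \<open>A divisor of \<open>p * m\<close> that \<open>p\<close> does not divide is coprime to
  \<open>p\<close>, hence divides \<open>m\<close>. Excluding multiples of \<open>p\<close> from the
  second set makes the union disjoint, so that sums over it split.\<close>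

lemma V_prime_mult:
  assumes "prime p"
  shows "V (p * m) = (*) p ` V m \<union> {a \<in> V m. \<not> p dvd a}"
proof (intro equalityI subsetI)
  fix a assume a: "a \<in> V (p * m)"
  show "a \<in> (*) p ` V m \<union> {a \<in> V m. \<not> p dvd a}"
  proof (cases "p dvd a")
    case True
    then obtain b where "a = p * b" by blast
    with a assms show ?thesis by (auto simp: V_def)
  next
    case False
    then have "coprime a p" using assms by (metis coprime_commute prime_imp_coprime)
    with a False show ?thesis by (auto simp: V_def coprime_dvd_mult_right_iff)
  qed
qed (use assms in \<open>auto simp: V_def prime_gt_0_nat\<close>)

lemma liouville_sum_prime_mult:
  assumes p: "prime p" and m: "m > 0"
  shows "liouville_sum (p * m) =
           (\<Sum>a | a \<in> V m \<and> \<not> p dvd a. (-1) ^ Omega a) - liouville_sum m"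
proof -
  have inj: "inj_on ((*) p) (V m)"
    using p by (auto simp: inj_on_def)
  have "liouville_sum (p * m) = (\<Sum>a\<in>(*) p ` V m. (-1) ^ Omega a) +
          (\<Sum>a | a \<in> V m \<and> \<not> p dvd a. (-1) ^ Omega a)"
    unfolding liouville_sum_def V_prime_mult[OF p]
    using finite_V[OF m] by (intro sum.union_disjoint) auto
  also have "(\<Sum>a\<in>(*) p ` V m. (-1) ^ Omega a) = (\<Sum>a\<in>V m. - ((-1) ^ Omega a) :: int)"
    unfolding sum.reindex[OF inj] o_def
    by (intro sum.cong) (auto simp: V_def Omega_prime_mult[OF p])
  finally show ?thesis by (simp add: liouville_sum_def sum_negf)
qed

text \<open>Strong induction, splitting off a prime \<open>p\<close>. If \<open>p\<close> divides
  \<open>m\<close> at least twice, removing \<open>p\<close> twice changes neither side; if it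
  divides \<open>m\<close> exactly once, both sides vanish.\<close>

lemma liouville_sum_eq:
  "m > 0 \<Longrightarrow> liouville_sum m = of_bool (is_nth_power 2 m)"
proof (induction m rule: less_induct)
  case (less m)
  show ?case
  proof (cases "m = 1")
    case True
    have "V 1 = {1}" by (auto simp: V_def)
    with True show ?thesis by (simp add: liouville_sum_def Omega_def)
  next
    case False
    then obtain p where p: "prime p" "p dvd m" by (metis prime_factor_nat)
    then obtain k where k: "m = p * k" by blast
    have k0: "k > 0" using less.prems k by simp
    show ?thesis
    proof (cases "p dvd k")
      case True
      then obtain l where l: "k = p * l" by blast
      have l0: "l > 0" using k0 l by simp
      \<comment> \<open>The recursions for \<open>p * k\<close> and \<open>p * l\<close> thus share
        the same first term; subtracting one from the other leaves the sum for
        \<open>l\<close>.\<close>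
      have eq: "{a \<in> V k. \<not> p dvd a} = {a \<in> V l. \<not> p dvd a}"
        unfolding l V_prime_mult[OF p(1)] by auto
      have "liouville_sum m = liouville_sum l"
        using liouville_sum_prime_mult[OF p(1) k0] liouville_sum_prime_mult[OF p(1) l0]
        by (simp add: k[symmetric] l[symmetric] eq)
      moreover have "l < m"
        using n_less_m_mult_n[OF l0 prime_gt_Suc_0_nat[OF p(1)]]
          n_less_m_mult_n[OF k0 prime_gt_Suc_0_nat[OF p(1)]]
        by (simp only: k[symmetric] l[symmetric] less_trans)
      moreover have "is_nth_power 2 m \<longleftrightarrow> is_nth_power 2 l"
      proof
        assume "is_nth_power 2 m"
        then obtain x where x: "m = x ^ 2" by (auto simp: is_nth_power_def)
        then have "p dvd x" using p prime_dvd_power by blast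
        then obtain y where "x = p * y" by blast
        with x k l p(1) have "l = y ^ 2" by (simp add: power2_eq_square)
        then show "is_nth_power 2 l" by auto
      next
        assume "is_nth_power 2 l"
        then obtain y where "l = y ^ 2" by (auto simp: is_nth_power_def)
        then have "m = (p * y) ^ 2" using k l by (simp add: power2_eq_square)
        then show "is_nth_power 2 m" by auto
      qed
      ultimately show ?thesis using less.IH l0 by simp
    next
      case False
      \<comment> \<open>With \<open>k\<close> free of \<open>p\<close>, the two terms of the
        recursion coincide and cancel.\<close>
      then have eq: "{a \<in> V k. \<not> p dvd a} = V k"
        by (auto simp: V_def)
      have "liouville_sum m = 0"
        unfolding k liouville_sum_prime_mult[OF p(1) k0]
        by (simp only: eq liouville_sum_def diff_self)
      moreover have "\<not> is_nth_power 2 m"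
      proof
        assume "is_nth_power 2 m"
        then obtain x where x: "m = x ^ 2" by (auto simp: is_nth_power_def)
        then have "p dvd x" using p prime_dvd_power by blast
        then obtain y where "x = p * y" by blast
        with x k p(1) have "k = p * y ^ 2" by (simp add: power2_eq_square)
        with False show False by simp
      qed
      ultimately show ?thesis by simp
    qed
  qed
qed

text \<open>If the primes differed, the multiplicity of \<open>p\<close> would be odd on the left
  and even on the right.\<close>

lemma prime_times_square_unique:
  fixes p q x y :: nat
  assumes "prime p" "prime q" "p * x ^ 2 = q * y ^ 2" "p * x ^ 2 > 0"
  shows "p = q"
proof (rule ccontr)
  assume "p \<noteq> q"
  then have "\<not> p dvd q" using assms primes_dvd_imp_eq by blast
  moreover have "x \<noteq> 0" using assms(4) by auto
  moreover have "y \<noteq> 0" using assms(4) unfolding assms(3) by auto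
  ultimately have "multiplicity p (p * x ^ 2) = Suc (2 * multiplicity p x)"
    and "multiplicity p (q * y ^ 2) = 2 * multiplicity p y"
    using assms(1,2)
    by (simp_all add: prime_elem_multiplicity_mult_distrib prime_elem_multiplicity_power_distrib
        not_dvd_imp_multiplicity_0)
  with assms(3) show False by presburger
qed

text \<open>Covering pairs are those with prime quotient. Indexing them by that prime first turns a
  sum over arcs into an iterated sum, as \<open>p * a\<close> divides \<open>n\<close> exactly when
  \<open>a\<close> divides \<open>n div p\<close>.\<close>

lemma E_H_eq:
  assumes "n > 0"
  shows "E_H n = (\<lambda>(p, a). (a, p * a)) ` Sigma (prime_factors n) (\<lambda>p. V (n div p))"
proof (intro equalityI subsetI)
  fix e assume e: "e \<in> E_H n"
  obtain a b where [simp]: "e = (a, b)" by force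
  from e have a: "a > 0" "a < b" "a dvd b" "b dvd n"
    and nc: "\<And>c. c \<in> V n \<Longrightarrow> a < c \<Longrightarrow> c < b \<Longrightarrow> a dvd c \<Longrightarrow> \<not> c dvd b"
    by (auto simp: E_H_def V_def)
  obtain k where k: "b = a * k" using a by blast
  then have "k \<noteq> 1" using a by auto
  then obtain p where p: "prime p" "p dvd k" by (metis prime_factor_nat)
  \<comment> \<open>The divisor \<open>a * p\<close> of \<open>b\<close> lies strictly above
    \<open>a\<close>, so the covering condition forces it to equal \<open>b\<close>.\<close>
  have c: "a * p dvd b" "a < a * p" "a * p dvd n"
    using k p a prime_gt_1_nat[OF p(1)] dvd_trans[of "a * p" b n] by auto
  have "a * p \<le> b" using c a by (auto intro: dvd_imp_le)
  then have b: "b = p * a"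
    using nc[of "a * p"] c a by (force simp: V_def mult.commute)
  have "p dvd n" using c by (metis dvd_mult_right)
  moreover have "a dvd n div p"
    using c \<open>p dvd n\<close> p(1) by (simp add: dvd_div_iff_mult)
  moreover have "n div p > 0" using \<open>p dvd n\<close> assms by auto
  ultimately show "e \<in> (\<lambda>(p, a). (a, p * a)) ` Sigma (prime_factors n) (\<lambda>p. V (n div p))"
    using b p a assms by (force simp: V_def in_prime_factors_iff)
next
  fix e assume "e \<in> (\<lambda>(p, a). (a, p * a)) ` Sigma (prime_factors n) (\<lambda>p. V (n div p))"
  then obtain p a where e: "e = (a, p * a)" and p: "prime p" "p dvd n"
    and a: "a > 0" "a dvd n div p"
    by (auto simp: V_def in_prime_factors_iff)
  have n: "p * a dvd n" using p a by (simp add: dvd_div_iff_mult mult.commute)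
  have "\<not> c dvd p * a" if c: "a dvd c" "a < c" "c < p * a" for c
  proof
    assume *: "c dvd p * a"
    obtain d where d: "c = a * d" using c by blast
    have "d dvd p" using * d a by (simp add: mult.commute)
    then have "d = 1 \<or> d = p" using p(1) by (simp add: prime_nat_iff)
    then show False using c d by auto
  qed
  moreover have "a dvd n" using n by (metis dvd_mult_right)
  ultimately show "e \<in> E_H n"
    using n a p prime_gt_1_nat[OF p(1)] unfolding e by (auto simp: E_H_def V_def prime_gt_0_nat)
qed

lemma sum_E_H:
  assumes n: "n > 0"
  shows "(\<Sum>(a, b)\<in>E_H n. (-1) ^ Omega a) = (\<Sum>p\<in>prime_factors n. liouville_sum (n div p))"
proof -
  have pos: "n div p > 0" if "p \<in> prime_factors n" for p
    using that n by (auto simp: in_prime_factors_iff elim!: dvdE)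
  \<comment> \<open>Since \<open>a\<close> is positive, \<open>p\<close> can be recovered from
    \<open>a\<close> and \<open>p * a\<close>.\<close>
  have inj: "inj_on (\<lambda>(p, a). (a, p * a)) (Sigma (prime_factors n) (\<lambda>p. V (n div p)))"
    by (auto simp: inj_on_def V_def)
  have "(\<Sum>(a, b)\<in>E_H n. (-1) ^ Omega a) =
      (\<Sum>(p, a)\<in>Sigma (prime_factors n) (\<lambda>p. V (n div p)). (-1) ^ Omega a :: int)"
    unfolding E_H_eq[OF n] sum.reindex[OF inj] by (intro sum.cong) auto
  also have "\<dots> = (\<Sum>p\<in>prime_factors n. liouville_sum (n div p))"
    unfolding liouville_sum_def using finite_V pos by (subst sum.Sigma) auto
  finally show ?thesis .
qed

lemma sum_liouville_sum_div_prime: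
  assumes n: "n > 0"
  shows "(\<Sum>p\<in>prime_factors n. liouville_sum (n div p)) \<in> {0, 1}"
proof -
  let ?S = "{p \<in> prime_factors n. is_nth_power 2 (n div p)}"
  have "(\<Sum>p\<in>prime_factors n. liouville_sum (n div p)) =
      (\<Sum>p\<in>prime_factors n. of_bool (is_nth_power 2 (n div p)))"
    using n by (intro sum.cong refl liouville_sum_eq) (auto simp: in_prime_factors_iff elim!: dvdE)
  also have "\<dots> = int (card ?S)"
    by (simp add: sum.If_cases of_bool_def Int_def)
  finally have eq: "(\<Sum>p\<in>prime_factors n. liouville_sum (n div p)) = int (card ?S)" .
  have "p = q" if pq: "p \<in> ?S" "q \<in> ?S" for p q
  proof -
    obtain x y where "n div p = x ^ 2" "n div q = y ^ 2"
      using pq by (auto simp: is_nth_power_def)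
    moreover have "p * (n div p) = n" "q * (n div q) = n" "prime p" "prime q"
      using pq by (auto simp: in_prime_factors_iff)
    ultimately show ?thesis using prime_times_square_unique n by metis
  qed
  then have "card ?S \<le> Suc 0" by (subst card_le_Suc0_iff_eq) auto
  with eq show ?thesis by (auto simp: le_Suc_eq)
qed

theorem theorem12:
  fixes n :: nat
  assumes "n > 0"
  shows "card (E_O n) = card (E_H n) div 2"
proof -
  have "E_H n \<subseteq> V n \<times> V n" by (auto simp: E_H_def)
  then have fin: "finite (E_H n)"
    using finite_V[OF assms] by (meson finite_SigmaI finite_subset)
  \<comment> \<open>Writing each sign as 1 minus twice the indicator of odd \<open>Omega\<close>
    brings \<open>card (E_O n)\<close> into the signed sum.\<close>
  have "(\<Sum>(a, b)\<in>E_H n. (-1) ^ Omega a) =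
      (\<Sum>e\<in>E_H n. 1 - 2 * of_bool (odd (Omega (fst e))) :: int)"
    by (intro sum.cong) (auto simp: of_bool_def)
  also have "\<dots> = int (card (E_H n)) - 2 * (\<Sum>e\<in>E_H n. of_bool (odd (Omega (fst e))))"
    by (simp add: sum_subtractf sum_distrib_left)
  also have "(\<Sum>e\<in>E_H n. of_bool (odd (Omega (fst e)))) = int (card (E_O n))"
  proof -
    have "E_O n = E_H n \<inter> {e. odd (Omega (fst e))}" by (auto simp: E_O_def)
    then show ?thesis using fin by (simp add: sum.If_cases of_bool_def)
  qed
  \<comment> \<open>The difference is therefore the remainder of \<open>card (E_H n)\<close> modulo
    2, which yields the floor.\<close>
  finally have "int (card (E_H n)) - 2 * int (card (E_O n)) \<in> {0, 1}"
    using sum_E_H[OF assms] sum_liouville_sum_div_prime[OF assms] by metis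
  then show ?thesis by auto
qed

end
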